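(* Every complex reflection group $G\subset U(\mathbb{C}^d)$ is a normal subgroup of its maximal reflection group, and it has the same collineation group as its maximal reflection group (i.e., it is a collineation preserving subgroup).
   Context: A reflection on $\mathbb{C}^d$ is an invertible linear map $g$ with $\mathrm{rank}(I-g)=1$; a complex reflection group is a finite group generated by reflections, taken to be unitary. A matrix is a hidden reflection if it is not a reflection but some nonzero scalar multiple of it is a reflection. The maximal reflection group for a complex reflection group $G$ is the group generated by the reflections in $G$ and the reflections given by its hidden reflections, i.e., the group generated by all reflections of the form $\lambda g$ with $\lambda\in\mathbb{C}^*$, $g\in G$. The collineation group of a matrix group is the group factored by its scalar matrices; two matrix groups have the same collineation group if they consist of the same matrices up to nonzero scalar multiples. *)

theory Defs
  imports "HOL-Analysis.Analysis" "HOL-Algebra.Algebra"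
begin

definition general_linear_group :: "(complex^'d^'d) monoid" where
  "general_linear_group = \<lparr>carrier = {A. invertible A}, mult = (**), one = mat 1\<rparr>"

definition conjugate_transpose :: "complex^'n^'m \<Rightarrow> complex^'m^'n" where
  "conjugate_transpose A = (\<chi> i j. cnj (A $ j $ i))"

definition unitary_matrix :: "complex^'d^'d \<Rightarrow> bool" where
  "unitary_matrix A \<longleftrightarrow>
     conjugate_transpose A ** A = mat 1 \<and> A ** conjugate_transpose A = mat 1"

definition reflection :: "complex^'d^'d \<Rightarrow> bool" where
  "reflection g \<longleftrightarrow> invertible g \<and> rank (mat 1 - g) = 1"

definition complex_reflection_group :: "(complex^'d^'d) set \<Rightarrow> bool" where
  "complex_reflection_group G \<longleftrightarrow>
     finite G \<and> (\<forall>g\<in>G. unitary_matrix g) \<and>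
     (\<exists>S. (\<forall>s\<in>S. reflection s) \<and> G = generate general_linear_group S)"

text \<open>
  The scalar multiple of \<open>g\<close> by \<open>c\<close> is written \<open>mat c ** g\<close>.

  A hidden reflection is a non-reflection having a nonzero scalar multiple that is a reflection.
  The generating set below consists of the reflections in \<open>G\<close> (\<open>c = 1\<close>) and the reflections that
  are multiples of hidden reflections in \<open>G\<close>; for \<open>d \<le> 2\<close> it can also contain further reflections
  that are nontrivial multiples of reflections in \<open>G\<close>, for example \<open>diag(-1,1) = - diag(1,-1)\<close>.
  For \<open>d = 1\<close> it consists of all scalars other than 0 and 1, so the generated group need be
  neither finite nor unitary and is therefore formed inside the general linear group.
\<close>
definition maximal_reflection_group :: "(complex^'d^'d) set \<Rightarrow> (complex^'d^'d) set" where
  "maximal_reflection_group G =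
     generate general_linear_group
       {mat c ** g | c g. c \<noteq> 0 \<and> g \<in> G \<and> reflection (mat c ** g)}"

definition same_collineation_group ::
    "(complex^'d^'d) set \<Rightarrow> (complex^'d^'d) set \<Rightarrow> bool" where
  "same_collineation_group G H \<longleftrightarrow>
     (\<forall>g\<in>G. \<exists>h\<in>H. \<exists>c. c \<noteq> 0 \<and> g = mat c ** h) \<and>
     (\<forall>h\<in>H. \<exists>g\<in>G. \<exists>c. c \<noteq> 0 \<and> h = mat c ** g)"

end

theory Submission
  imports Defs
begin

text \<open>
  The matrices \<open>mat c ** g\<close> with \<open>c \<noteq> 0\<close> and \<open>g \<in> G\<close> form a group, since the scalars are central.
  It contains the generators of the maximal reflection group, hence the whole of it. Conjugation by
  \<open>mat c ** g\<close> agrees with conjugation by \<open>g\<close>, so it preserves \<open>G\<close>.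
\<close>

text \<open>Row \<open>i\<close> of \<open>mat c\<close> has its only possibly nonzero entry on the
  diagonal, so the sum defining the product collapses to one term. Identities about scalar matrices
  thereby reduce to arithmetic in the coefficients.\<close>

lemma mat_mult_nth: "(mat c ** A) $ i $ j = c * (A :: 'a::semiring_1^'m^'n) $ i $ j"
  by (simp add: matrix_matrix_mult_def mat_def if_distrib[of "\<lambda>x. x * _"] sum.delta'
      cong: if_cong)

lemma mult_mat_nth: "(A ** mat c) $ i $ j = (A :: 'a::semiring_1^'m^'n) $ i $ j * c"
  by (simp add: matrix_matrix_mult_def mat_def if_distrib[of "\<lambda>x. _ * x"] sum.delta cong: if_cong)

lemma mat_mult_mat: "mat a ** mat b = (mat (a * b) :: 'a::semiring_1^'n^'n)"
  by (simp add: vec_eq_iff mat_mult_nth) (simp add: mat_def)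

lemma mat_mult_commute: "mat c ** A = A ** (mat c :: 'a::comm_semiring_1^'n^'n)"
  by (simp add: vec_eq_iff mat_mult_nth mult_mat_nth mult.commute)

lemma invertible_mat:
  fixes c :: "'a::field"
  assumes "c \<noteq> 0"
  shows "invertible (mat c :: 'a^'n^'n)"
  using assms unfolding invertible_def
  by (intro exI[of _ "mat (inverse c)"]) (simp add: mat_mult_mat)

lemma group_general_linear_group: "group (general_linear_group :: (complex^'d^'d) monoid)"
proof (rule groupI)
  fix A :: "complex^'d^'d"
  assume "A \<in> carrier general_linear_group"
  \<comment> \<open>Both equations are needed: \<open>B ** A = mat 1\<close> is the left inverse
    law, and the two together show that \<open>B\<close> is itself invertible and so lies in the
    carrier.\<close>
  then obtain B where "A ** B = mat 1" "B ** A = mat 1"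
    by (auto simp: general_linear_group_def invertible_def)
  then show "\<exists>B\<in>carrier general_linear_group.
      B \<otimes>\<^bsub>general_linear_group\<^esub> A = \<one>\<^bsub>general_linear_group\<^esub>"
    by (auto simp: general_linear_group_def invertible_def)
qed (auto simp: general_linear_group_def invertible_mult invertible_mat matrix_mul_assoc)

definition scalar_matrices :: "(complex^'d^'d) set" where
  "scalar_matrices = {mat c | c. c \<noteq> 0}"

text \<open>Scalar matrices commute with every matrix, so left and right cosets agree element by
  element. Normality is what later makes the product set of the scalars with \<open>G\<close> a
  subgroup.\<close>

lemma scalar_matrices_normal: "scalar_matrices \<lhd> general_linear_group"
proof -
  interpret GL: group general_linear_group
    by (rule group_general_linear_group)
  have inv_mat: "inv\<^bsub>general_linear_group\<^esub> (mat c) = (mat (inverse c) :: complex^'d^'d)"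
    if "c \<noteq> 0" for c
    using that
    by (intro GL.inv_equality) (auto simp: general_linear_group_def invertible_mat mat_mult_mat)
  have "subgroup scalar_matrices (general_linear_group :: (complex^'d^'d) monoid)"
  proof (rule GL.subgroupI)
    show "(scalar_matrices :: (complex^'d^'d) set) \<noteq> {}"
      by (auto simp: scalar_matrices_def intro: exI[of _ 1])
    show "inv\<^bsub>general_linear_group\<^esub> A \<in> scalar_matrices"
      if "A \<in> scalar_matrices" for A :: "complex^'d^'d"
      using that by (auto simp: scalar_matrices_def inv_mat)
    show "A \<otimes>\<^bsub>general_linear_group\<^esub> B \<in> scalar_matrices"
      if "A \<in> scalar_matrices" "B \<in> scalar_matrices" for A B :: "complex^'d^'d"
      using that by (auto simp: scalar_matrices_def general_linear_group_def mat_mult_mat)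
  qed (auto simp: scalar_matrices_def general_linear_group_def invertible_mat)
  moreover have "scalar_matrices #>\<^bsub>general_linear_group\<^esub> A =
      A <#\<^bsub>general_linear_group\<^esub> scalar_matrices" for A :: "complex^'d^'d"
    by (auto simp: r_coset_def l_coset_def scalar_matrices_def general_linear_group_def
        mat_mult_commute)
  ultimately show ?thesis
    by (intro GL.normalI) auto
qed

text \<open>By centrality \<open>z\<close> moves past the whole conjugate of \<open>x\<close> by
  \<open>g\<close> and then cancels against its inverse. It will be used with \<open>z\<close> a
  scalar matrix.\<close>

lemma (in group) central_conjugate:
  assumes "z \<in> carrier G" "g \<in> carrier G" "x \<in> carrier G"
    and central: "\<And>y. y \<in> carrier G \<Longrightarrow> z \<otimes> y = y \<otimes> z"
  shows "(z \<otimes> g) \<otimes> x \<otimes> inv (z \<otimes> g) = g \<otimes> x \<otimes> inv g"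
proof -
  have "(z \<otimes> g) \<otimes> x \<otimes> inv (z \<otimes> g) = z \<otimes> (g \<otimes> x \<otimes> inv g) \<otimes> inv z"
    using assms(1-3) by (simp add: inv_mult_group m_assoc)
  also have "\<dots> = (g \<otimes> x \<otimes> inv g) \<otimes> z \<otimes> inv z"
    using assms by (simp only: central m_closed inv_closed)
  finally show ?thesis
    using assms(1-3) by (simp add: m_assoc)
qed

theorem lemma3p1:
  fixes G :: "(complex^'d^'d) set"
  assumes "complex_reflection_group G"
  shows "normal G (general_linear_group\<lparr>carrier := maximal_reflection_group G\<rparr>) \<and>
         same_collineation_group G (maximal_reflection_group G)"
proof -
  let ?GL = "general_linear_group :: (complex^'d^'d) monoid"
  let ?M = "maximal_reflection_group G"
  interpret GL: group ?GL
    by (rule group_general_linear_group)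
  obtain S where S: "\<And>s. s \<in> S \<Longrightarrow> reflection s" and G: "G = generate ?GL S"
    using assms unfolding complex_reflection_group_def by blast
  have "S \<subseteq> carrier ?GL"
    using S by (auto simp: general_linear_group_def reflection_def)
  then have subG: "subgroup G ?GL"
    unfolding G by (rule GL.generate_is_subgroup)
  have subM: "subgroup ?M ?GL"
    unfolding maximal_reflection_group_def
    by (rule GL.generate_is_subgroup) (auto simp: general_linear_group_def reflection_def)
  have GM: "G \<subseteq> ?M"
  proof -
    \<comment> \<open>Elements of \<open>S\<close> are reflections lying in \<open>G\<close>, so the
      scalar 1 makes them generators of \<open>?M\<close>.\<close>
    have "S \<subseteq> {mat c ** g | c g. c \<noteq> 0 \<and> g \<in> G \<and> reflection (mat c ** g)}"
    proof
      fix s assume s: "s \<in> S"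
      then have "s \<in> G"
        unfolding G by (rule generate.incl)
      then show "s \<in> {mat c ** g | c g. c \<noteq> 0 \<and> g \<in> G \<and> reflection (mat c ** g)}"
        using S[OF s] by (auto intro!: exI[of _ "1::complex"] exI[of _ s])
    qed
    \<comment> \<open>Only the left-hand \<open>G\<close> is replaced by
      \<open>generate ?GL S\<close>; the \<open>G\<close> inside the generating set has to stay for
      the inclusion just shown to apply.\<close>
    then show ?thesis
      unfolding maximal_reflection_group_def by (subst G) (rule GL.mono_generate)
  qed
  have "subgroup (scalar_matrices <#>\<^bsub>?GL\<^esub> G) ?GL"
    by (rule GL.mult_norm_subgroup[OF scalar_matrices_normal subG])
  then have "?M \<subseteq> scalar_matrices <#>\<^bsub>?GL\<^esub> G"
    unfolding maximal_reflection_group_def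
    by (intro GL.generate_subgroup_incl)
      (auto simp: set_mult_def scalar_matrices_def general_linear_group_def)
  \<comment> \<open>This decomposition serves twice: it reduces conjugation by \<open>h\<close> to
    conjugation by \<open>g\<close>, and it is one half of the collineation claim.\<close>
  then have M_cases: "\<exists>g\<in>G. \<exists>c. c \<noteq> 0 \<and> h = mat c ** g" if "h \<in> ?M" for h
    using that by (force simp: set_mult_def scalar_matrices_def general_linear_group_def)
  have "G \<lhd> ?GL\<lparr>carrier := ?M\<rparr>"
  proof (rule group.normal_invI)
    show "group (?GL\<lparr>carrier := ?M\<rparr>)"
      by (rule GL.subgroup_imp_group[OF subM])
    show "subgroup G (?GL\<lparr>carrier := ?M\<rparr>)"
      by (rule GL.subgroup_incl[OF subG subM GM])
    fix h x
    assume "h \<in> carrier (?GL\<lparr>carrier := ?M\<rparr>)" and x: "x \<in> G"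
    then have h: "h \<in> ?M"
      by simp
    \<comment> \<open>The product is phrased with the multiplication of \<open>?GL\<close> so that
      \<open>GL.central_conjugate\<close> applies with \<open>mat c\<close> as the central
      element.\<close>
    then obtain g c where g: "g \<in> G" and c: "c \<noteq> 0" and hg: "h = mat c \<otimes>\<^bsub>?GL\<^esub> g"
      using M_cases by (force simp: general_linear_group_def)
    have "h \<otimes>\<^bsub>?GL\<^esub> x \<otimes>\<^bsub>?GL\<^esub> inv\<^bsub>?GL\<^esub> h = g \<otimes>\<^bsub>?GL\<^esub> x \<otimes>\<^bsub>?GL\<^esub> inv\<^bsub>?GL\<^esub> g"
      unfolding hg
    proof (rule GL.central_conjugate)
      show "g \<in> carrier ?GL" "x \<in> carrier ?GL"
        using g x subG by (auto dest: subgroup.mem_carrier)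
    qed (auto simp: general_linear_group_def invertible_mat c mat_mult_commute)
    also have "\<dots> \<in> G"
      using g x subG by (simp add: subgroup.m_closed subgroup.m_inv_closed)
    finally show "h \<otimes>\<^bsub>?GL\<lparr>carrier := ?M\<rparr>\<^esub> x \<otimes>\<^bsub>?GL\<lparr>carrier := ?M\<rparr>\<^esub>
        inv\<^bsub>?GL\<lparr>carrier := ?M\<rparr>\<^esub> h \<in> G"
      \<comment> \<open>Inverses taken in \<open>?M\<close> agree with those of \<open>?GL\<close>,
        so the computation in \<open>?GL\<close> carries over.\<close>
      using GL.m_inv_consistent[OF subM h] by simp
  qed
  moreover have "same_collineation_group G ?M"
    unfolding same_collineation_group_def
  proof (intro conjI ballI)
    fix g assume "g \<in> G"
    then show "\<exists>h\<in>?M. \<exists>c. c \<noteq> 0 \<and> g = mat c ** h"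
      using GM by (auto intro!: bexI[of _ g] exI[of _ "1::complex"])
  qed (rule M_cases)
  ultimately show ?thesis ..
qed

end
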